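(* For every $p_x>0$ and every $\lambda>1$, the effective coherence time $\hat T_{\rm c}$ defined in the context satisfies $$\frac{\hat T_{\rm c}(p_x)}{\lambda}\le\hat T_{\rm c}(\lambda p_x)\le\hat T_{\rm c}(p_x).$$
   Context: Let $N\ge1$ be an integer. Let $(\Delta_k)_{k\ge0}$ be the covariance matrices of a stationary unit-variance complex Gaussian sequence (the common normalized autocorrelation of the channel taps): $\Delta_k$ is a $(k+1)\times(k+1)$ Hermitian positive semi-definite Toeplitz matrix with unit diagonal, with rows and columns indexed by $0,\dots,k$, and $\Delta_{k-1}$ is the leading principal $k\times k$ submatrix of $\Delta_k$. Let $D_k\in\mathbb C^k$ be the vector with entries $(\Delta_k)_{i,k}$, $i=0,\dots,k-1$. The effective coherence time at SNR $p>0$ is $$\hat T_{\rm c}(p)=2N\lim_{k\to\infty}D_k^\dagger\left(Np\,[\Delta_{k-1}-D_kD_k^\dagger]+I\right)^{-1}D_k+N,$$ where $\dagger$ is conjugate transpose and the limit is allowed to be $+\infty$. *)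

theory Defs
  imports "Jordan_Normal_Form.Gauss_Jordan_Elimination"
    "Jordan_Normal_Form.Schur_Decomposition"
    "HOL-Library.Extended_Real"
begin

definition hermitian_mat :: "complex mat \<Rightarrow> bool" where
  "hermitian_mat A \<longleftrightarrow> square_mat A \<and> mat_adjoint A = A"

text \<open>
  The quadratic form \<open>(A *\<^sub>v v) \<bullet>c v\<close> is \<open>v\<^sup>\<dagger> A v\<close>. The order is the one of
  \<^theory>\<open>HOL-Library.Complex_Order\<close>: \<open>0 \<le> z\<close> says that \<open>z\<close> is real and nonnegative.
\<close>
definition psd_mat :: "complex mat \<Rightarrow> bool" where
  "psd_mat A \<longleftrightarrow> hermitian_mat A \<and>
     (\<forall>v \<in> carrier_vec (dim_row A). 0 \<le> (A *\<^sub>v v) \<bullet>c v)"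

definition toeplitz_mat :: "complex mat \<Rightarrow> bool" where
  "toeplitz_mat A \<longleftrightarrow>
     (\<forall>i j. Suc i < dim_row A \<longrightarrow> Suc j < dim_col A \<longrightarrow> A $$ (Suc i, Suc j) = A $$ (i, j))"

text \<open>
  The matrices \<open>\<Delta>\<^sub>k\<close>, of size \<open>k + 1\<close>. These conditions characterise the families of covariance
  matrices of unit-variance stationary complex (circularly symmetric) Gaussian sequences.
\<close>
definition stationary_covariance :: "(nat \<Rightarrow> complex mat) \<Rightarrow> bool" where
  "stationary_covariance \<Delta> \<longleftrightarrow>
     (\<forall>k. \<Delta> k \<in> carrier_mat (Suc k) (Suc k) \<and> psd_mat (\<Delta> k) \<and> toeplitz_mat (\<Delta> k) \<and>
          (\<forall>i \<le> k. \<Delta> k $$ (i, i) = 1)) \<and>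
     (\<forall>k \<ge> 1. \<Delta> (k - 1) = mat k k (\<lambda>(i, j). \<Delta> k $$ (i, j)))"

definition D_vec :: "(nat \<Rightarrow> complex mat) \<Rightarrow> nat \<Rightarrow> complex vec" where
  "D_vec \<Delta> k = vec k (\<lambda>i. \<Delta> k $$ (i, k))"

definition outer_self :: "complex vec \<Rightarrow> complex mat" where
  "outer_self v = mat (dim_vec v) (dim_vec v) (\<lambda>(i, j). v $ i * cnj (v $ j))"

text \<open>
  The quantity under the limit, \<open>D\<^sub>k\<^sup>\<dagger> (N p [\<Delta>\<^sub>k\<^sub>-\<^sub>1 - D\<^sub>k D\<^sub>k\<^sup>\<dagger>] + I)\<^sup>-\<^sup>1 D\<^sub>k\<close>. It is meaningful for
  \<open>k \<ge> 1\<close> only; the matrix \<open>\<Delta>\<^sub>k\<^sub>-\<^sub>1 - D\<^sub>k D\<^sub>k\<^sup>\<dagger>\<close> is a Schur complement of \<open>\<Delta>\<^sub>k\<close>, so that for \<open>p > 0\<close>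
  the inverse exists and the value is real and nonnegative.
\<close>
definition coherence_form :: "nat \<Rightarrow> (nat \<Rightarrow> complex mat) \<Rightarrow> real \<Rightarrow> nat \<Rightarrow> complex" where
  "coherence_form N \<Delta> p k =
     (the (mat_inverse
        (complex_of_real (real N * p) \<cdot>\<^sub>m (\<Delta> (k - 1) - outer_self (D_vec \<Delta> k)) + 1\<^sub>m k))
      *\<^sub>v D_vec \<Delta> k) \<bullet>c D_vec \<Delta> k"

text \<open>The limit is taken in the extended reals, since it may be \<open>\<infinity>\<close>.\<close>
definition coherence_time :: "nat \<Rightarrow> (nat \<Rightarrow> complex mat) \<Rightarrow> real \<Rightarrow> ereal" where
  "coherence_time N \<Delta> p =
     ereal (2 * real N) * lim (\<lambda>k. ereal (Re (coherence_form N \<Delta> p k))) + ereal (real N)"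

end

theory Submission
  imports Defs
begin

text \<open>
  For positive semi-definite \<open>S\<close> and \<open>c \<ge> 0\<close>, the number \<open>d\<^sup>\<dagger> (c S + I)\<^sup>-\<^sup>1 d\<close> is the maximum over \<open>v\<close>
  of the concave functional \<open>2 Re (v\<^sup>\<dagger> d) - c v\<^sup>\<dagger> S v - v\<^sup>\<dagger> v\<close>. Hence it decreases in \<open>c\<close>; rescaling the
  maximiser by \<open>1 / l\<close> shows that replacing \<open>c\<close> by \<open>l c\<close> loses at most a factor \<open>l\<close>; and
  extending the maximiser by a zero in front shows that the coherence forms increase with \<open>k\<close>,
  because by the Toeplitz property \<open>\<Delta>\<^sub>k\<^sub>-\<^sub>1 - D\<^sub>k D\<^sub>k\<^sup>\<dagger>\<close> is the trailing principal submatrix of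
  \<open>\<Delta>\<^sub>k - D\<^sub>k\<^sub>+\<^sub>1 D\<^sub>k\<^sub>+\<^sub>1\<^sup>\<dagger>\<close>. So the limit exists in the extended reals and inherits both inequalities.
\<close>

section \<open>Sesquilinear forms and Hermitian matrices in coordinates\<close>

lemma cscalar_prod_conv_sum:
  fixes v w :: "complex vec"
  assumes "w \<in> carrier_vec n"
  shows "v \<bullet>c w = (\<Sum>i<n. v $ i * cnj (w $ i))"
  using assms by (auto simp: scalar_prod_def atLeast0LessThan intro!: sum.cong)

lemma mult_mat_vec_cscalar_conv_sum:
  fixes A :: "complex mat"
  assumes "A \<in> carrier_mat n n" "v \<in> carrier_vec n" "w \<in> carrier_vec n"
  shows "(A *\<^sub>v v) \<bullet>c w = (\<Sum>i<n. \<Sum>j<n. A $$ (i, j) * v $ j * cnj (w $ i))"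
proof -
  have "(A *\<^sub>v v) $ i = (\<Sum>j<n. A $$ (i, j) * v $ j)" if "i < n" for i
    using assms that by (auto simp: scalar_prod_def atLeast0LessThan intro!: sum.cong)
  then show ?thesis
    by (simp add: cscalar_prod_conv_sum[OF assms(3)] sum_distrib_right)
qed

lemma mat_adjoint_index:
  fixes A :: "complex mat"
  assumes "A \<in> carrier_mat n n" "i < n" "j < n"
  shows "mat_adjoint A $$ (i, j) = cnj (A $$ (j, i))"
  using assms by (simp add: mat_adjoint_def mat_of_rows_def)

lemma hermitian_mat_index:
  assumes "hermitian_mat A" "A \<in> carrier_mat n n" "i < n" "j < n"
  shows "A $$ (i, j) = cnj (A $$ (j, i))"
  using assms mat_adjoint_index[OF assms(2-4)] by (simp add: hermitian_mat_def)

lemma hermitian_matI: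
  assumes A: "A \<in> carrier_mat n n"
    and "\<And>i j. i < n \<Longrightarrow> j < n \<Longrightarrow> A $$ (i, j) = cnj (A $$ (j, i))"
  shows "hermitian_mat A"
  unfolding hermitian_mat_def
proof (intro conjI eq_matI)
  show "mat_adjoint A $$ (i, j) = A $$ (i, j)" if "i < dim_row A" "j < dim_col A" for i j
    using that A assms(2)[of i j] mat_adjoint_index[OF A, of i j] by auto
qed (use A in \<open>auto simp: mat_adjoint_def\<close>)

lemma hermitian_mat_cscalar_swap:
  assumes "hermitian_mat A" "A \<in> carrier_mat n n" "v \<in> carrier_vec n" "w \<in> carrier_vec n"
  shows "(A *\<^sub>v v) \<bullet>c w = cnj ((A *\<^sub>v w) \<bullet>c v)"
proof -
  have "cnj ((A *\<^sub>v w) \<bullet>c v) = (\<Sum>i<n. \<Sum>j<n. cnj (A $$ (i, j)) * cnj (w $ j) * v $ i)"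
    by (simp add: mult_mat_vec_cscalar_conv_sum[OF assms(2,4,3)])
  also have "\<dots> = (\<Sum>j<n. \<Sum>i<n. cnj (A $$ (i, j)) * cnj (w $ j) * v $ i)"
    by (rule sum.swap)
  also have "\<dots> = (\<Sum>j<n. \<Sum>i<n. A $$ (j, i) * v $ i * cnj (w $ j))"
  proof (intro sum.cong refl)
    show "cnj (A $$ (i, j)) * cnj (w $ j) * v $ i = A $$ (j, i) * v $ i * cnj (w $ j)"
      if "i \<in> {..<n}" "j \<in> {..<n}" for i j
      using that hermitian_mat_index[OF assms(1,2), of j i] by simp
  qed
  finally show ?thesis
    by (simp add: mult_mat_vec_cscalar_conv_sum[OF assms(2,3,4)])
qed

section \<open>Variational characterisation of the resolvent form\<close>

definition resolvent_form :: "real \<Rightarrow> complex mat \<Rightarrow> complex vec \<Rightarrow> real" where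
  "resolvent_form c S d =
     Re ((the (mat_inverse (complex_of_real c \<cdot>\<^sub>m S + 1\<^sub>m (dim_row S))) *\<^sub>v d) \<bullet>c d)"

definition energy :: "real \<Rightarrow> complex mat \<Rightarrow> complex vec \<Rightarrow> complex vec \<Rightarrow> real" where
  "energy c S d v = 2 * Re (d \<bullet>c v) - c * Re ((S *\<^sub>v v) \<bullet>c v) - Re (v \<bullet>c v)"

lemma psd_mat_form_nonneg:
  assumes "psd_mat S" "S \<in> carrier_mat n n" "v \<in> carrier_vec n"
  shows "0 \<le> Re ((S *\<^sub>v v) \<bullet>c v)"
  using assms unfolding psd_mat_def by (auto simp: less_eq_complex_def)

lemma Re_cscalar_self_nonneg: "0 \<le> Re ((v :: complex vec) \<bullet>c v)"
  using conjugate_square_ge_0_vec[of v] by (auto simp: less_eq_complex_def)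

lemma hermitian_mat_smult_add_one:
  assumes "hermitian_mat S" "S \<in> carrier_mat n n"
  shows "hermitian_mat (complex_of_real c \<cdot>\<^sub>m S + 1\<^sub>m n)"
proof (rule hermitian_matI)
  show "(complex_of_real c \<cdot>\<^sub>m S + 1\<^sub>m n) $$ (i, j) =
      cnj ((complex_of_real c \<cdot>\<^sub>m S + 1\<^sub>m n) $$ (j, i))" if "i < n" "j < n" for i j
    using that assms(2) hermitian_mat_index[OF assms that] by auto
qed (use assms(2) in simp)

lemma smult_add_one_mult_vec_cscalar:
  fixes S :: "complex mat"
  assumes S: "S \<in> carrier_mat n n" and v: "v \<in> carrier_vec n" and w: "w \<in> carrier_vec n"
  shows "((c \<cdot>\<^sub>m S + 1\<^sub>m n) *\<^sub>v v) \<bullet>c w = c * ((S *\<^sub>v v) \<bullet>c w) + v \<bullet>c w"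
proof -
  have "(c \<cdot>\<^sub>m S + 1\<^sub>m n) *\<^sub>v v = c \<cdot>\<^sub>v (S *\<^sub>v v) + v"
    using assms by (intro eq_vecI) (auto simp: add_scalar_prod_distrib[of _ n])
  then show ?thesis
    using assms by (simp add: add_scalar_prod_distrib[of _ n])
qed

text \<open>A vector \<open>v\<close> in the kernel of \<open>B\<close> satisfies c v*Sv + v*v = 0
  with both terms nonnegative, which forces v = 0. So \<open>B\<close> is invertible, and
  \<open>the\<close> is applied to an actual inverse.\<close>

lemma mat_inverse_smult_psd_add_one:
  assumes S: "psd_mat S" "S \<in> carrier_mat n n" and c: "0 \<le> c"
  defines "B \<equiv> complex_of_real c \<cdot>\<^sub>m S + 1\<^sub>m n"
  shows "the (mat_inverse B) \<in> carrier_mat n n" "B * the (mat_inverse B) = 1\<^sub>m n"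
proof -
  have B: "B \<in> carrier_mat n n"
    using S by (simp add: B_def)
  have "det B \<noteq> 0"
  proof
    assume "det B = 0"
    then obtain v where v: "v \<in> carrier_vec n" "v \<noteq> 0\<^sub>v n" "B *\<^sub>v v = 0\<^sub>v n"
      using det_0_iff_vec_prod_zero_field[OF B] by auto
    have "c * Re ((S *\<^sub>v v) \<bullet>c v) + Re (v \<bullet>c v) = 0"
      using smult_add_one_mult_vec_cscalar[OF S(2) v(1) v(1), of "complex_of_real c"] v
      by (simp add: B_def flip: complex_eq_iff) (simp add: complex_eq_iff)
    moreover have "0 \<le> c * Re ((S *\<^sub>v v) \<bullet>c v)"
      using psd_mat_form_nonneg[OF S v(1)] c by simp
    ultimately have "Re (v \<bullet>c v) = 0"
      using Re_cscalar_self_nonneg[of v] by linarith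
    moreover have "0 < v \<bullet>c v"
      using v by simp
    ultimately show False
      by (simp add: less_complex_def)
  qed
  then obtain X where "mat_inverse B = Some X"
    using mat_inverse(1)[OF B, where b = "()"] det_non_zero_imp_unit[OF B, where b = "()"]
    by (cases "mat_inverse B") auto
  then show "the (mat_inverse B) \<in> carrier_mat n n" "B * the (mat_inverse B) = 1\<^sub>m n"
    using mat_inverse(2)[OF B] by auto
qed

text \<open>Completing the square: with B = cS + I and x the solution of Bx = d, the difference
  \<open>resolvent_form c S d - energy c S d v\<close> equals the real part of (v - x)*B(v - x).
  This is nonnegative and vanishes at v = x.\<close>

lemma
  assumes S: "psd_mat S" "S \<in> carrier_mat n n" and c: "0 \<le> c" and d: "d \<in> carrier_vec n"
  shows energy_le_resolvent_form:
      "\<And>v. v \<in> carrier_vec n \<Longrightarrow> energy c S d v \<le> resolvent_form c S d"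
    and resolvent_form_attained:
      "\<exists>v \<in> carrier_vec n. energy c S d v = resolvent_form c S d"
proof -
  define B where "B = complex_of_real c \<cdot>\<^sub>m S + 1\<^sub>m n"
  define x where "x = the (mat_inverse B) *\<^sub>v d"
  note inv = mat_inverse_smult_psd_add_one[OF S c, folded B_def]
  have B: "B \<in> carrier_mat n n"
    using S by (simp add: B_def)
  have x: "x \<in> carrier_vec n"
    using inv d by (simp add: x_def)
  have Bx: "B *\<^sub>v x = d"
    using inv d B by (simp add: x_def flip: assoc_mult_mat_vec)
  have F: "resolvent_form c S d = Re (x \<bullet>c d)"
    using S by (simp add: resolvent_form_def x_def B_def)
  have herm: "hermitian_mat B"
    using S by (simp add: B_def psd_mat_def hermitian_mat_smult_add_one)
  have form: "Re ((B *\<^sub>v v) \<bullet>c v) = c * Re ((S *\<^sub>v v) \<bullet>c v) + Re (v \<bullet>c v)"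
    if "v \<in> carrier_vec n" for v
    using smult_add_one_mult_vec_cscalar[OF S(2) that that] by (simp add: B_def)
  have dx: "Re (d \<bullet>c x) = Re (x \<bullet>c d)"
    using x d by (simp add: cscalar_prod_conv_sum[of _ n] algebra_simps)
  have "energy c S d x = Re (x \<bullet>c d)"
    using form[OF x] dx Bx by (simp add: energy_def)
  then show "\<exists>v \<in> carrier_vec n. energy c S d v = resolvent_form c S d"
    using x F by auto
  fix v :: "complex vec" assume v: "v \<in> carrier_vec n"
  have "0 \<le> Re ((B *\<^sub>v (v - x)) \<bullet>c (v - x))"
    using form[of "v - x"] psd_mat_form_nonneg[OF S, of "v - x"] Re_cscalar_self_nonneg c v x
    by simp
  also have "(B *\<^sub>v (v - x)) \<bullet>c (v - x) =
      (B *\<^sub>v v) \<bullet>c v - (B *\<^sub>v v) \<bullet>c x - (B *\<^sub>v x) \<bullet>c v + (B *\<^sub>v x) \<bullet>c x"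
    using v x B
    by (simp add: mult_mat_vec_cscalar_conv_sum[OF B] algebra_simps
        sum.distrib sum_subtractf del: mult_minus_distrib_mat_vec)
  \<comment> \<open>Since \<open>B\<close> is Hermitian and Bx = d, the two cross terms are
    conjugate to each other; together they contribute twice the real part of
    \<open>d \<bullet>c v\<close>, the linear term of the energy.\<close>
  also have "(B *\<^sub>v v) \<bullet>c x = cnj (d \<bullet>c v)"
    using hermitian_mat_cscalar_swap[OF herm B v x] Bx by simp
  finally show "energy c S d v \<le> resolvent_form c S d"
    using form[OF v] F dx Bx by (simp add: energy_def)
qed

section \<open>Comparison of maxima under a change of parameter or of matrix size\<close>

lemma resolvent_form_antimono:
  assumes S: "psd_mat S" "S \<in> carrier_mat n n" and c: "0 \<le> c" "c \<le> c'"
    and d: "d \<in> carrier_vec n"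
  shows "resolvent_form c' S d \<le> resolvent_form c S d"
proof -
  \<comment> \<open>The maximiser for the larger parameter \<open>c'\<close> is the useful one: its
    energy can only grow when the parameter drops to \<open>c\<close>.\<close>
  obtain v where v: "v \<in> carrier_vec n" "energy c' S d v = resolvent_form c' S d"
    using resolvent_form_attained[OF S _ d, of c'] c by auto
  have "energy c' S d v \<le> energy c S d v"
    using mult_right_mono[OF c(2) psd_mat_form_nonneg[OF S v(1)]] by (simp add: energy_def)
  also have "\<dots> \<le> resolvent_form c S d"
    by (rule energy_le_resolvent_form[OF S c(1) d v(1)])
  finally show ?thesis
    using v by simp
qed

lemma resolvent_form_le_scaled:
  assumes S: "psd_mat S" "S \<in> carrier_mat n n" and c: "0 \<le> c" and l: "1 \<le> l"
    and d: "d \<in> carrier_vec n"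
  shows "resolvent_form c S d \<le> l * resolvent_form (l * c) S d"
proof -
  obtain v where v: "v \<in> carrier_vec n" "energy c S d v = resolvent_form c S d"
    using resolvent_form_attained[OF S c d] by auto
  define w where "w = complex_of_real (1 / l) \<cdot>\<^sub>v v"
  have w: "w \<in> carrier_vec n"
    using v by (simp add: w_def)
  have conj: "conjugate w = complex_of_real (1 / l) \<cdot>\<^sub>v conjugate v"
    by (simp add: w_def conjugate_smult_vec)
  have 1: "Re (d \<bullet>c w) = Re (d \<bullet>c v) / l"
    using v d by (simp add: conj scalar_prod_smult_distrib[of _ n])
  have 2: "Re ((S *\<^sub>v w) \<bullet>c w) = Re ((S *\<^sub>v v) \<bullet>c v) / l\<^sup>2"
  proof -
    have "S *\<^sub>v w = complex_of_real (1 / l) \<cdot>\<^sub>v (S *\<^sub>v v)"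
      using mult_mat_vec[OF S(2) v(1)] by (simp add: w_def)
    then show ?thesis
      using v S by (simp add: conj power2_eq_square)
  qed
  have 3: "Re (w \<bullet>c w) = Re (v \<bullet>c v) / l\<^sup>2"
    using v by (simp add: conj power2_eq_square) (simp add: w_def)
  \<comment> \<open>Under v -> v/l the linear term scales by 1/l and both quadratic terms by 1/l^2.
    The outer factor \<open>l\<close> and the factor \<open>l\<close> in front of \<open>c\<close>
    restore the linear term and the \<open>S\<close> term exactly; only v*v keeps a factor 1/l,
    which is favourable because l >= 1.\<close>
  have "l * energy (l * c) S d w =
      2 * Re (d \<bullet>c v) - c * Re ((S *\<^sub>v v) \<bullet>c v) - Re (v \<bullet>c v) / l"
    using l by (simp add: energy_def 1 2 3 field_simps power2_eq_square)
  moreover have "Re (v \<bullet>c v) / l \<le> Re (v \<bullet>c v)"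
    using l Re_cscalar_self_nonneg[of v] mult_left_mono[of 1 l "Re (v \<bullet>c v)"]
    by (simp add: field_simps)
  ultimately have "energy c S d v \<le> l * energy (l * c) S d w"
    by (simp add: energy_def)
  also have "\<dots> \<le> l * resolvent_form (l * c) S d"
    using energy_le_resolvent_form[OF S _ d w, of "l * c"] c l by simp
  finally show ?thesis
    using v by simp
qed

lemma resolvent_form_le_extension:
  assumes S: "psd_mat S" "S \<in> carrier_mat n n" and d: "d \<in> carrier_vec n"
    and T: "psd_mat T" "T \<in> carrier_mat (Suc n) (Suc n)" and e: "e \<in> carrier_vec (Suc n)"
    and c: "0 \<le> c"
    and TS: "\<And>i j. i < n \<Longrightarrow> j < n \<Longrightarrow> T $$ (Suc i, Suc j) = S $$ (i, j)"
    and ed: "\<And>i. i < n \<Longrightarrow> e $ Suc i = d $ i"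
  shows "resolvent_form c S d \<le> resolvent_form c T e"
proof -
  obtain v where v: "v \<in> carrier_vec n" "energy c S d v = resolvent_form c S d"
    using resolvent_form_attained[OF S c d] by auto
  \<comment> \<open>The leading zero hides the first row and column of \<open>T\<close> and the
    first entry of \<open>e\<close>, about which nothing is known here.\<close>
  define w where "w = vCons 0 v"
  have w: "w \<in> carrier_vec (Suc n)"
    using v by (simp add: w_def)
  have [simp]: "w $ 0 = 0" "\<And>i. i < n \<Longrightarrow> w $ Suc i = v $ i"
    using v by (auto simp: w_def)
  have "e \<bullet>c w = d \<bullet>c v" "w \<bullet>c w = v \<bullet>c v"
    using ed by (simp_all add: cscalar_prod_conv_sum[OF w] cscalar_prod_conv_sum[OF v(1)]
        sum.lessThan_Suc_shift del: sum.lessThan_Suc)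
  moreover have "(T *\<^sub>v w) \<bullet>c w = (S *\<^sub>v v) \<bullet>c v"
    using TS by (simp add: mult_mat_vec_cscalar_conv_sum[OF T(2) w w]
        mult_mat_vec_cscalar_conv_sum[OF S(2) v(1) v(1)] sum.lessThan_Suc_shift
        del: sum.lessThan_Suc)
  ultimately have "energy c S d v = energy c T e w"
    by (simp add: energy_def)
  then show ?thesis
    using energy_le_resolvent_form[OF T c e w] v by simp
qed

section \<open>Schur complements and prediction errors of a stationary sequence\<close>

lemma psd_mat_schur_complement:
  assumes A: "psd_mat A" "A \<in> carrier_mat (Suc n) (Suc n)" and one: "A $$ (n, n) = 1"
    and S: "S \<in> carrier_mat n n"
    and S_index: "\<And>i j. i < n \<Longrightarrow> j < n \<Longrightarrow>
      S $$ (i, j) = A $$ (i, j) - A $$ (i, n) * cnj (A $$ (j, n))"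
  shows "psd_mat S"
  unfolding psd_mat_def
proof (intro conjI ballI)
  have herm: "A $$ (i, j) = cnj (A $$ (j, i))" if "i \<le> n" "j \<le> n" for i j
    using A that hermitian_mat_index[of A "Suc n" i j] by (auto simp: psd_mat_def)
  show "hermitian_mat S"
  proof (rule hermitian_matI[OF S])
    show "S $$ (i, j) = cnj (S $$ (j, i))" if "i < n" "j < n" for i j
      using that herm[of i j] by (simp add: S_index)
  qed
  fix v :: "complex vec" assume "v \<in> carrier_vec (dim_row S)"
  with S have v: "v \<in> carrier_vec n"
    by simp
  \<comment> \<open>With the first \<open>n\<close> coordinates fixed to \<open>v\<close>, the form
    of \<open>A\<close> is minimised by the last coordinate -t, as the corner entry is 1. The
    minimum is the form of the Schur complement at \<open>v\<close>.\<close>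
  define t where "t = (\<Sum>i<n. cnj (A $$ (i, n)) * v $ i)"
  define w where "w = vec (Suc n) (\<lambda>i. if i < n then v $ i else - t)"
  have w: "w \<in> carrier_vec (Suc n)"
    by (simp add: w_def)
  have cnj_t: "(\<Sum>i<n. A $$ (i, n) * cnj (v $ i)) = cnj t"
    by (simp add: t_def)
  have t': "(\<Sum>i<n. A $$ (n, i) * v $ i) = t"
    unfolding t_def by (intro sum.cong refl) (simp add: herm[of n])
  define q where "q = (\<Sum>i<n. \<Sum>j<n. A $$ (i, j) * v $ j * cnj (v $ i))"
  have "(A *\<^sub>v w) \<bullet>c w = q - t * (\<Sum>i<n. A $$ (i, n) * cnj (v $ i))
      - (\<Sum>i<n. A $$ (n, i) * v $ i) * cnj t + t * cnj t"
    unfolding mult_mat_vec_cscalar_conv_sum[OF A(2) w w]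
    by (simp add: w_def q_def one sum.distrib sum_subtractf sum_negf sum_distrib_left
        algebra_simps)
  also have "\<dots> = q - t * cnj t"
    by (simp add: cnj_t t')
  also have "\<dots> = (S *\<^sub>v v) \<bullet>c v"
  proof -
    have "(S *\<^sub>v v) \<bullet>c v = q -
        (\<Sum>i<n. \<Sum>j<n. A $$ (i, n) * cnj (v $ i) * (cnj (A $$ (j, n)) * v $ j))"
      unfolding mult_mat_vec_cscalar_conv_sum[OF S v v] q_def
      by (simp add: S_index sum_subtractf algebra_simps)
    also have "(\<Sum>i<n. \<Sum>j<n. A $$ (i, n) * cnj (v $ i) * (cnj (A $$ (j, n)) * v $ j))
        = cnj t * t"
      by (simp add: t_def sum_product)
    finally show ?thesis
      by simp
  qed
  finally show "0 \<le> (S *\<^sub>v v) \<bullet>c v"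
    using A w unfolding psd_mat_def by auto
qed

text \<open>The error covariance when samples 0, ..., k-1 are linearly estimated from sample k,
  which has unit variance.\<close>

definition prediction_error_mat :: "(nat \<Rightarrow> complex mat) \<Rightarrow> nat \<Rightarrow> complex mat" where
  "prediction_error_mat \<Delta> k = \<Delta> (k - 1) - outer_self (D_vec \<Delta> k)"

context
  fixes \<Delta> :: "nat \<Rightarrow> complex mat"
  assumes cov: "stationary_covariance \<Delta>"
begin

lemma covariance_carrier: "\<Delta> k \<in> carrier_mat (Suc k) (Suc k)"
  using cov by (auto simp: stationary_covariance_def)

lemma covariance_restrict:
  assumes "i \<le> k" "j \<le> k"
  shows "\<Delta> (Suc k) $$ (i, j) = \<Delta> k $$ (i, j)"
proof -
  have "\<forall>k \<ge> 1. \<Delta> (k - 1) = mat k k (\<lambda>(i, j). \<Delta> k $$ (i, j))"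
    using cov unfolding stationary_covariance_def by blast
  from this[rule_format, of "Suc k"]
  have "\<Delta> k = mat (Suc k) (Suc k) (\<lambda>(i, j). \<Delta> (Suc k) $$ (i, j))"
    by simp
  from arg_cong[OF this, of "\<lambda>M. M $$ (i, j)"] show ?thesis
    using assms by simp
qed

lemma covariance_shift:
  assumes "i \<le> k" "j \<le> k"
  shows "\<Delta> (Suc k) $$ (Suc i, Suc j) = \<Delta> k $$ (i, j)"
proof -
  have "toeplitz_mat (\<Delta> (Suc k))"
    using cov by (simp add: stationary_covariance_def)
  then show ?thesis
    using assms covariance_carrier[of "Suc k"] covariance_restrict[OF assms]
    by (auto simp: toeplitz_mat_def)
qed

text \<open>By stationarity the correlations depend on the lag alone, so passing from
  \<open>k\<close> to \<open>Suc k\<close> adds the new entry at the front. This is why vectors are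
  extended there and not at the end.\<close>

lemma D_vec_shift: "i < k \<Longrightarrow> D_vec \<Delta> (Suc k) $ Suc i = D_vec \<Delta> k $ i"
  using covariance_shift[of i k k] by (simp add: D_vec_def)

lemma D_vec_carrier: "D_vec \<Delta> k \<in> carrier_vec k"
  by (simp add: D_vec_def)

text \<open>This includes k = 0, where \<open>k - 1\<close> truncates to 0: a matrix difference
  takes its dimensions from the subtracted matrix, here 0 by 0. Hence the coherence forms can be
  compared from k = 0 on.\<close>

lemma prediction_error_carrier:
  "prediction_error_mat \<Delta> k \<in> carrier_mat k k"
  by (auto simp: prediction_error_mat_def outer_self_def D_vec_def)

lemma prediction_error_index:
  assumes "i < k" "j < k"
  shows "prediction_error_mat \<Delta> k $$ (i, j) =
    \<Delta> k $$ (i, j) - D_vec \<Delta> k $ i * cnj (D_vec \<Delta> k $ j)"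
  using assms covariance_restrict[of i "k - 1" j] covariance_carrier[of "k - 1"]
  by (auto simp: prediction_error_mat_def outer_self_def D_vec_def)

lemma psd_prediction_error: "psd_mat (prediction_error_mat \<Delta> k)"
proof (rule psd_mat_schur_complement)
  show "psd_mat (\<Delta> k)" "\<Delta> k $$ (k, k) = 1"
    using cov by (auto simp: stationary_covariance_def)
qed (auto simp: covariance_carrier prediction_error_carrier prediction_error_index D_vec_def)

lemma prediction_error_shift:
  assumes "i < k" "j < k"
  shows "prediction_error_mat \<Delta> (Suc k) $$ (Suc i, Suc j) = prediction_error_mat \<Delta> k $$ (i, j)"
  using assms covariance_shift[of i k j] by (simp add: prediction_error_index D_vec_shift)

lemma Re_coherence_form:
  "Re (coherence_form N \<Delta> p k) =
    resolvent_form (real N * p) (prediction_error_mat \<Delta> k) (D_vec \<Delta> k)"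
proof -
  have "dim_row (prediction_error_mat \<Delta> k) = k"
    using prediction_error_carrier by blast
  then show ?thesis
    unfolding coherence_form_def resolvent_form_def prediction_error_mat_def[symmetric] by simp
qed

section \<open>Passage to the limit in the extended reals\<close>

lemma coherence_form_tendsto:
  assumes "0 \<le> p"
  shows "(\<lambda>k. ereal (Re (coherence_form N \<Delta> p k)))
    \<longlonglongrightarrow> lim (\<lambda>k. ereal (Re (coherence_form N \<Delta> p k)))"
proof -
  \<comment> \<open>Monotonicity gives convergence to the supremum, possibly infinite;
    \<open>lim\<close> is a definite description and says nothing about a divergent
    sequence.\<close>
  have "incseq (\<lambda>k. ereal (Re (coherence_form N \<Delta> p k)))"
    unfolding Re_coherence_form using assms
    by (intro incseq_SucI) (auto intro!: resolvent_form_le_extension psd_prediction_error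
        prediction_error_carrier D_vec_carrier prediction_error_shift D_vec_shift)
  from LIMSEQ_SUP[OF this] show ?thesis
    by (auto simp: convergent_LIMSEQ_iff[symmetric] convergent_def)
qed

lemma coherence_time_antimono:
  assumes "0 \<le> p" "p \<le> q"
  shows "coherence_time N \<Delta> q \<le> coherence_time N \<Delta> p"
proof -
  have "lim (\<lambda>k. ereal (Re (coherence_form N \<Delta> q k))) \<le>
      lim (\<lambda>k. ereal (Re (coherence_form N \<Delta> p k)))"
  proof (rule LIMSEQ_le)
    show "\<exists>K. \<forall>k\<ge>K. ereal (Re (coherence_form N \<Delta> q k)) \<le> ereal (Re (coherence_form N \<Delta> p k))"
      using assms by (auto simp: Re_coherence_form intro!: resolvent_form_antimono
          psd_prediction_error prediction_error_carrier D_vec_carrier mult_left_mono)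
  qed (use assms coherence_form_tendsto in auto)
  then show ?thesis
    unfolding coherence_time_def by (intro add_right_mono ereal_mult_left_mono) auto
qed

lemma coherence_time_le_scaled:
  assumes p: "0 \<le> p" and l: "1 \<le> l"
  shows "coherence_time N \<Delta> p / ereal l \<le> coherence_time N \<Delta> (l * p)"
proof -
  define L where "L q = lim (\<lambda>k. ereal (Re (coherence_form N \<Delta> q k)))" for q
  have "L p \<le> ereal l * L (l * p)"
  proof (rule LIMSEQ_le)
    show "(\<lambda>k. ereal (Re (coherence_form N \<Delta> p k))) \<longlonglongrightarrow> L p"
      using coherence_form_tendsto p by (simp add: L_def)
    show "(\<lambda>k. ereal l * ereal (Re (coherence_form N \<Delta> (l * p) k))) \<longlonglongrightarrow> ereal l * L (l * p)"
      unfolding L_def using p l by (intro tendsto_cmult_ereal coherence_form_tendsto) auto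
    have "Re (coherence_form N \<Delta> p k) \<le> l * Re (coherence_form N \<Delta> (l * p) k)" for k
      using resolvent_form_le_scaled[OF psd_prediction_error prediction_error_carrier _ l
          D_vec_carrier, of "real N * p" k] p
      by (simp add: Re_coherence_form mult.left_commute)
    then show "\<exists>K. \<forall>k\<ge>K. ereal (Re (coherence_form N \<Delta> p k)) \<le>
        ereal l * ereal (Re (coherence_form N \<Delta> (l * p) k))"
      by simp
  qed
  then have "ereal (2 * real N) * L p \<le> ereal (2 * real N) * (ereal l * L (l * p))"
    by (intro ereal_mult_left_mono) auto
  \<comment> \<open>The additive constant N also has to be bounded by its multiple by
    \<open>l\<close>, so that \<open>l\<close> can be factored out of the whole sum.\<close>
  moreover have "ereal (real N) \<le> ereal l * ereal (real N)"
    using mult_right_mono[OF l, of "real N"] by simp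
  ultimately have "coherence_time N \<Delta> p \<le>
      ereal (2 * real N) * (ereal l * L (l * p)) + ereal l * ereal (real N)"
    unfolding coherence_time_def L_def[symmetric] by (rule add_mono)
  also have "\<dots> = ereal l * coherence_time N \<Delta> (l * p)"
    unfolding coherence_time_def L_def[symmetric]
    \<comment> \<open>Distributivity is safe even when the limit is infinite, because
      \<open>l\<close> is finite and nonnegative.\<close>
    using distrib_left_ereal_nn[of l "ereal (2 * real N) * L (l * p)" "ereal (real N)"] l
    by (simp only: ac_simps)
  finally show ?thesis
    using l by (subst ereal_divide_le_pos) auto
qed

end

theorem mainTheorem4:
  fixes N :: nat and \<Delta> :: "nat \<Rightarrow> complex mat" and p l :: real
  assumes "N \<ge> 1" and "stationary_covariance \<Delta>" and "p > 0" and "l > 1"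
  shows "coherence_time N \<Delta> p / ereal l \<le> coherence_time N \<Delta> (l * p) \<and>
         coherence_time N \<Delta> (l * p) \<le> coherence_time N \<Delta> p"
  using assms by (auto intro: coherence_time_le_scaled coherence_time_antimono)

end
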